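(* Let $n\ge1$ and $I_n>0$. Then $$\nu(A)^{\frac{n-1}{n}}\le I_n P_m(A)\quad\text{for all } \nu\text{-measurable } A\subset X \text{ with } 0<\nu(A)<\nu(X)$$ if, and only if, $$\|u\|_{L^{\frac{n}{n-1}}(X,\nu)}\le I_n\,TV_m(u)\quad\text{for all } u\in BV_m^0(X,\nu).$$ That is, $[X,d,m,\nu]$ has isoperimetric dimension $n$ if, and only if, this Sobolev inequality holds, with the same constant $I_n$.
   Context: Metric random walk space: $(X,d)$ is a Polish metric space with its Borel $\sigma$-algebra and $m=(m_x)_{x\in X}$ is a family of Borel probability measures on $X$ such that $x\mapsto m_x(A)$ is Borel for every Borel set $A$, and each $m_x$ has finite first moment ($\int_X d(z,y)\,dm_x(y)<\infty$ for some, hence every, $z\in X$). $\nu$ is a $\sigma$-finite Radon measure on $X$ that is invariant, $\nu(A)=\int_X m_x(A)\,d\nu(x)$, and reversible for $m$: for every Borel $C\subset X\times X$, $\int_X\int_X\chi_C(x,y)\,dm_x(y)d\nu(x)=\int_X\int_X\chi_C(x,y)\,dm_y(x)d\nu(y)$. Put $L_m(A,B)=\int_A\int_B dm_x(y)d\nu(x)$; the space is assumed $m$-connected: $L_m(A,B)>0$ for any $\nu$-measurable sets $A,B$ of positive $\nu$-measure with $A\cup B=X$. $P_m(E)=L_m(E,X\setminus E)=\int_E\int_{X\setminus E}dm_x(y)d\nu(x)$. For $\nu$-measurable $u:X\to\mathbb R$, $TV_m(u)=\frac12\int_X\int_X|u(y)-u(x)|\,dm_x(y)d\nu(x)$, and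 $BV_m(X,\nu)$ is the set of $\nu$-measurable $u$ with $TV_m(u)<\infty$. $BV_m^0(X,\nu)$ is the set of $u\in BV_m(X,\nu)$ for which there is $A\subset X$ with $0<\nu(A)<\nu(X)$ such that $u=0$ in $X\setminus A$. Convention: $\frac{n}{n-1}=+\infty$ for $n=1$. $[X,d,m,\nu]$ has isoperimetric dimension $n$ if there is a constant $I_n>0$ for which the first displayed inequality holds. *)

theory Defs
  imports "HOL-Probability.Probability" "HOL-Probability.Essential_Supremum"
begin

text \<open>
  The metric space $(X,d)$ is a type of class \<^class>\<open>polish_space\<close> (complete, separable),
  with \<^const>\<open>dist\<close> as $d$; the random walk is a kernel \<open>m :: 'a \<Rightarrow> 'a measure\<close>.
\<close>

definition random_walk :: "('a::polish_space \<Rightarrow> 'a measure) \<Rightarrow> bool" where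
  "random_walk m \<longleftrightarrow>
     (\<forall>x. prob_space (m x) \<and> sets (m x) = sets borel) \<and>
     (\<forall>A\<in>sets borel. (\<lambda>x. emeasure (m x) A) \<in> borel_measurable borel) \<and>
     (\<forall>x. \<exists>z. (\<integral>\<^sup>+y. ennreal (dist z y) \<partial>m x) < \<infinity>)"

definition radon_measure :: "'a::polish_space measure \<Rightarrow> bool" where
  "radon_measure \<nu> \<longleftrightarrow>
     sets \<nu> = sets borel \<and>
     (\<forall>x. \<exists>U. open U \<and> x \<in> U \<and> emeasure \<nu> U < \<infinity>) \<and>
     (\<forall>B\<in>sets borel. emeasure \<nu> B = (SUP K\<in>{K. compact K \<and> K \<subseteq> B}. emeasure \<nu> K))"

definition invariant_measure :: "('a::polish_space \<Rightarrow> 'a measure) \<Rightarrow> 'a measure \<Rightarrow> bool" where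
  "invariant_measure m \<nu> \<longleftrightarrow>
     (\<forall>A\<in>sets borel. emeasure \<nu> A = (\<integral>\<^sup>+x. emeasure (m x) A \<partial>\<nu>))"

definition reversible_measure :: "('a::polish_space \<Rightarrow> 'a measure) \<Rightarrow> 'a measure \<Rightarrow> bool" where
  "reversible_measure m \<nu> \<longleftrightarrow>
     (\<forall>C\<in>sets (borel :: ('a \<times> 'a) measure).
        (\<integral>\<^sup>+x. (\<integral>\<^sup>+y. indicator C (x, y) \<partial>m x) \<partial>\<nu>) =
        (\<integral>\<^sup>+y. (\<integral>\<^sup>+x. indicator C (x, y) \<partial>m y) \<partial>\<nu>))"

text \<open>
  ``$\nu$-measurable'' refers to the completion of \<open>\<nu>\<close>. By invariance a $\nu$-null Borel set is
  $m_x$-null for $\nu$-a.e. $x$, so $\nu$-measurable sets and functions are measurable for the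
  completion of $m_x$ for $\nu$-a.e. $x$. Hence the double integrals below, with both measures
  completed, are the intended ones; the exceptional $x$ form a $\nu$-null set.
\<close>

definition Lm :: "('a::polish_space \<Rightarrow> 'a measure) \<Rightarrow> 'a measure \<Rightarrow> 'a set \<Rightarrow> 'a set \<Rightarrow> ennreal" where
  "Lm m \<nu> A B =
     (\<integral>\<^sup>+x. indicator A x * (\<integral>\<^sup>+y. indicator B y \<partial>completion (m x)) \<partial>completion \<nu>)"

definition m_connected :: "('a::polish_space \<Rightarrow> 'a measure) \<Rightarrow> 'a measure \<Rightarrow> bool" where
  "m_connected m \<nu> \<longleftrightarrow>
     (\<forall>A\<in>sets (completion \<nu>). \<forall>B\<in>sets (completion \<nu>).
        0 < emeasure (completion \<nu>) A \<longrightarrow> 0 < emeasure (completion \<nu>) B \<longrightarrow>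
        A \<union> B = UNIV \<longrightarrow> 0 < Lm m \<nu> A B)"

definition Pm :: "('a::polish_space \<Rightarrow> 'a measure) \<Rightarrow> 'a measure \<Rightarrow> 'a set \<Rightarrow> ennreal" where
  "Pm m \<nu> E = Lm m \<nu> E (UNIV - E)"

definition TVm :: "('a::polish_space \<Rightarrow> 'a measure) \<Rightarrow> 'a measure \<Rightarrow> ('a \<Rightarrow> real) \<Rightarrow> ennreal" where
  "TVm m \<nu> u =
     ennreal (1 / 2) * (\<integral>\<^sup>+x. (\<integral>\<^sup>+y. ennreal \<bar>u y - u x\<bar> \<partial>completion (m x)) \<partial>completion \<nu>)"

definition BVm :: "('a::polish_space \<Rightarrow> 'a measure) \<Rightarrow> 'a measure \<Rightarrow> ('a \<Rightarrow> real) set" where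
  "BVm m \<nu> = {u \<in> borel_measurable (completion \<nu>). TVm m \<nu> u < \<infinity>}"

definition BVm0 :: "('a::polish_space \<Rightarrow> 'a measure) \<Rightarrow> 'a measure \<Rightarrow> ('a \<Rightarrow> real) set" where
  "BVm0 m \<nu> = {u \<in> BVm m \<nu>. \<exists>A\<in>sets (completion \<nu>).
     0 < emeasure (completion \<nu>) A \<and> emeasure (completion \<nu>) A < emeasure (completion \<nu>) UNIV \<and>
     (\<forall>x. x \<notin> A \<longrightarrow> u x = 0)}"

text \<open>
  Powers of extended nonnegative reals with a real exponent \<open>r \<ge> 0\<close>. As for \<^const>\<open>powr\<close>,
  $0^0 = 0$; this value is never used below.
\<close>

definition epowr :: "ennreal \<Rightarrow> real \<Rightarrow> ennreal" where
  "epowr a r = (if a = \<infinity> then (if r = 0 then 1 else \<infinity>) else ennreal (enn2real a powr r))"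

definition Lp_norm :: "'a measure \<Rightarrow> ennreal \<Rightarrow> ('a \<Rightarrow> real) \<Rightarrow> ennreal" where
  "Lp_norm M p u =
     (if p = \<infinity> then esssup M (\<lambda>x. ennreal \<bar>u x\<bar>)
      else epowr (\<integral>\<^sup>+x. ennreal (\<bar>u x\<bar> powr enn2real p) \<partial>M) (1 / enn2real p))"

definition sobolev_exponent :: "real \<Rightarrow> ennreal" where
  "sobolev_exponent n = (if n = 1 then \<infinity> else ennreal (n / (n - 1)))"

definition isoperimetric_inequality ::
  "('a::polish_space \<Rightarrow> 'a measure) \<Rightarrow> 'a measure \<Rightarrow> real \<Rightarrow> real \<Rightarrow> bool" where
  "isoperimetric_inequality m \<nu> n I \<longleftrightarrow>
     (\<forall>A\<in>sets (completion \<nu>).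
        0 < emeasure (completion \<nu>) A \<longrightarrow>
        emeasure (completion \<nu>) A < emeasure (completion \<nu>) UNIV \<longrightarrow>
        epowr (emeasure (completion \<nu>) A) ((n - 1) / n) \<le> ennreal I * Pm m \<nu> A)"

definition has_isoperimetric_dimension ::
  "('a::polish_space \<Rightarrow> 'a measure) \<Rightarrow> 'a measure \<Rightarrow> real \<Rightarrow> bool" where
  "has_isoperimetric_dimension m \<nu> n \<longleftrightarrow> (\<exists>I>0. isoperimetric_inequality m \<nu> n I)"

end

theory Submission
  imports Defs
begin

text \<open>
  Both inequalities are statements about level sets. For a $\nu$-measurable \<open>u\<close>, reversibility
  gives the coarea formula \<open>TV(u) = \<integral> P({u > t}) dt\<close> over all real \<open>t\<close> (lemma \<open>coarea\<close>): the jump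
  \<open>\<bar>u y - u x\<bar>\<close> is the length of the set of \<open>t\<close> with exactly one of \<open>x\<close>, \<open>y\<close> in \<open>{u > t}\<close>, and
  reversibility makes jumps into \<open>{u > t}\<close> as frequent as jumps out of it, which cancels the
  factor $1/2$.

  From Sobolev to isoperimetric: take \<open>u\<close> to be the indicator of \<open>A\<close>. Its only nontrivial level set
  is \<open>A\<close>, so the coarea formula gives \<open>TV(u) = P(A)\<close>, and its norm is $\nu(A)^{(n-1)/n}$.

  From isoperimetric to Sobolev: replacing \<open>u\<close> by \<open>\<bar>u\<bar>\<close> does not increase \<open>TV\<close>, and for \<open>t \<ge> 0\<close> the
  level sets \<open>{\<bar>u\<bar> > t}\<close> lie in the set \<open>A\<close> outside which \<open>u\<close> vanishes, so the isoperimetric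
  inequality applies to each of those that is not null. Integrating over \<open>t\<close>, it remains to see that
  the $L^p$ norm of \<open>u\<close> is at most the integral over \<open>t \<ge> 0\<close> of the $L^p$ norms of the indicators
  of \<open>{\<bar>u\<bar> > t}\<close>. This is Minkowski's integral inequality for \<open>\<bar>u\<bar> = \<integral> 1{\<bar>u\<bar> > t} dt\<close>
  (lemma \<open>Lp_norm_sobolev_exponent_le_level_integral\<close>). It is obtained from Hoelder's inequality
  on each level set, after a truncation that makes the norm finite; for \<open>p = \<infinity>\<close> it only says that
  the level sets below the essential supremum are not null.

  Measurability is meant with respect to the completion of \<open>\<nu>\<close>. Invariance carries a $\nu$-null set to
  a set that is $m_x$-null for almost every \<open>x\<close> (lemma \<open>AE_step\<close>), so \<open>TV\<close> and \<open>P\<close> do not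
  change when functions and sets are replaced by Borel representatives.
\<close>

section \<open>Bounding an \<open>L\<^sup>p\<close> norm by its level sets\<close>

text \<open>
  Hoelder's inequality for $v^{p-1}$ and the indicator of \<open>E\<close>, which have conjugate exponents
  $p/(p-1)$ and \<open>p\<close>. With \<open>\<alpha> = 1 - 1/p\<close> and \<open>\<beta> = 1/p\<close>, Young's inequality for the normalised
  functions $v^p/S$ and $1_E/\mu$, each of integral \<open>1\<close>, integrates to \<open>\<alpha> + \<beta> = 1\<close>.
\<close>

lemma Hoelder_on_set:
  fixes v :: "'a \<Rightarrow> real"
  assumes [measurable]: "v \<in> borel_measurable M" "E \<in> sets M"
    and v0: "\<And>x. 0 \<le> v x" and p: "1 < p"
    and S: "(\<integral>\<^sup>+x. ennreal (v x powr p) \<partial>M) = ennreal S" "0 < S"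
    and \<mu>: "emeasure M E = ennreal \<mu>" "0 < \<mu>"
  shows "(\<integral>\<^sup>+x. ennreal (v x powr (p - 1)) * indicator E x \<partial>M)
           \<le> ennreal (S powr (1 - 1 / p)) * ennreal (\<mu> powr (1 / p))"
proof -
  define \<alpha> \<beta> where "\<alpha> = 1 - 1 / p" and "\<beta> = 1 / p"
  have ab: "0 \<le> \<alpha>" "0 \<le> \<beta>" "\<alpha> + \<beta> = 1" "p * \<alpha> = p - 1"
    using p by (auto simp: \<alpha>_def \<beta>_def field_simps)
  define C where "C = S powr \<alpha> * \<mu> powr \<beta>"
  have C: "0 \<le> C" by (simp add: C_def)
  have young: "v x powr (p - 1) \<le> C * (\<alpha> / S * v x powr p + \<beta> / \<mu>)" for x
  proof (cases "v x = 0")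
    case True
    then show ?thesis using C ab \<mu> S by simp
  next
    case False
    then have pos: "0 < v x" using v0[of x] by simp
    have "(v x powr p / S) powr \<alpha> * (1 / \<mu>) powr \<beta> \<le> \<alpha> * (v x powr p / S) + \<beta> * (1 / \<mu>)"
      using ab S \<mu> pos by (intro Youngs_inequality_0) auto
    moreover have "(v x powr p / S) powr \<alpha> * (1 / \<mu>) powr \<beta> = v x powr (p - 1) / C"
      using ab S \<mu> pos by (simp add: powr_divide powr_powr C_def)
    moreover have "0 < C" using S \<mu> by (simp add: C_def)
    ultimately show ?thesis by (simp add: pos_divide_le_eq mult.commute)
  qed
  have "(\<integral>\<^sup>+x. ennreal (v x powr (p - 1)) * indicator E x \<partial>M)
      \<le> (\<integral>\<^sup>+x. ennreal C * (ennreal (\<alpha> / S) * ennreal (v x powr p)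
             + ennreal (\<beta> / \<mu>) * indicator E x) \<partial>M)"
  proof (rule nn_integral_mono)
    fix x
    have "ennreal (v x powr (p - 1)) \<le> ennreal (C * (\<alpha> / S * v x powr p + \<beta> / \<mu>))"
      by (rule ennreal_leI) (rule young)
    also have "\<dots> = ennreal C * (ennreal (\<alpha> / S) * ennreal (v x powr p) + ennreal (\<beta> / \<mu>))"
      using C ab S(2) \<mu>(2) by (simp add: ennreal_mult ennreal_plus del: times_divide_eq_left)
    finally show "ennreal (v x powr (p - 1)) * indicator E x
        \<le> ennreal C * (ennreal (\<alpha> / S) * ennreal (v x powr p) + ennreal (\<beta> / \<mu>) * indicator E x)"
      by (simp add: indicator_def)
  qed
  also have "\<dots> = ennreal C * (ennreal (\<alpha> / S) * ennreal S + ennreal (\<beta> / \<mu>) * ennreal \<mu>)"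
    by (simp add: nn_integral_cmult nn_integral_add S \<mu>)
  also have "\<dots> = ennreal C"
    using ab S \<mu> by (simp flip: ennreal_mult ennreal_plus)
  also have "\<dots> = ennreal (S powr \<alpha>) * ennreal (\<mu> powr \<beta>)"
    by (simp add: C_def ennreal_mult)
  finally show ?thesis by (simp add: \<alpha>_def \<beta>_def)
qed

lemma epowr_root_le_iff:
  assumes "0 < p" "0 \<le> j"
  shows "epowr a (1 / p) \<le> ennreal j \<longleftrightarrow> a \<le> ennreal (j powr p)"
proof (cases a)
  case (real r)
  have "r powr (1 / p) \<le> j \<longleftrightarrow> r \<le> j powr p"
    using assms real powr_mono2[of "1/p" r "j powr p"] powr_mono2[of p "r powr (1/p)" j]
    by (auto simp: powr_powr)
  then show ?thesis using real assms by (simp add: epowr_def)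
qed (use assms in \<open>simp add: epowr_def top_unique\<close>)

lemma epowr_measurable [measurable]: "(\<lambda>a. epowr a r) \<in> borel_measurable borel"
  unfolding epowr_def by measurable

lemma epowr_mono: "0 \<le> r \<Longrightarrow> a \<le> b \<Longrightarrow> b < \<infinity> \<Longrightarrow> epowr a r \<le> epowr b r"
  by (cases a; cases b) (auto simp: epowr_def top_unique intro!: ennreal_leI powr_mono2)

lemma epowr_0: "0 < a \<Longrightarrow> epowr a 0 = 1"
  by (cases a) (auto simp: epowr_def)

lemma (in sigma_finite_measure) level_measure_measurable:
  assumes [measurable]: "v \<in> borel_measurable M"
  shows "(\<lambda>t::real. emeasure M {x\<in>space M. t < v x}) \<in> borel_measurable borel"
proof -
  let ?Q = "{z \<in> space (borel \<Otimes>\<^sub>M M). fst z < v (snd z)}"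
  have *: "Pair t -` ?Q = {x\<in>space M. t < v x}" for t
    by (auto simp: space_pair_measure)
  have "?Q \<in> sets (borel \<Otimes>\<^sub>M M)" by measurable
  from measurable_emeasure_Pair[OF this] show ?thesis unfolding * .
qed

text \<open>
  Write $v^p = v^{p-1}\int_0^\infty 1_{v>t}\,dt$, exchange the integrals and apply Hoelder's
  inequality for every \<open>t\<close>. With $S = \int v^p$ this gives $S \le S^{1-1/p}\,J$, where \<open>J\<close> is the
  right-hand side. Finiteness of \<open>S\<close> is what allows the division by $S^{1-1/p}$.
\<close>

lemma (in sigma_finite_measure) Lp_norm_le_level_integral_if_finite:
  fixes v :: "'a \<Rightarrow> real"
  assumes [measurable]: "v \<in> borel_measurable M"
    and v0: "\<And>x. 0 \<le> v x" and p: "1 < p"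
    and supp: "emeasure M {x\<in>space M. 0 < v x} < \<infinity>"
    and fin: "(\<integral>\<^sup>+x. ennreal (v x powr p) \<partial>M) < \<infinity>"
  shows "epowr (\<integral>\<^sup>+x. ennreal (v x powr p) \<partial>M) (1 / p)
           \<le> (\<integral>\<^sup>+t\<in>{0..}. epowr (emeasure M {x\<in>space M. t < v x}) (1 / p) \<partial>lborel)"
    (is "_ \<le> ?J")
proof -
  have [measurable]: "(\<lambda>t::real. emeasure M {x\<in>space M. t < v x}) \<in> borel_measurable borel"
    by (rule level_measure_measurable[OF assms(1)])
  interpret pair_sigma_finite lborel M ..
  obtain S where S: "0 \<le> S" "(\<integral>\<^sup>+x. ennreal (v x powr p) \<partial>M) = ennreal S"
    using fin by (cases "\<integral>\<^sup>+x. ennreal (v x powr p) \<partial>M") auto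
  show ?thesis
  proof (cases "S = 0")
    case True
    then show ?thesis using S by (simp add: epowr_def)
  next
    case False
    then have Spos: "0 < S" using S by simp
    have layer: "ennreal (v x powr p)
        = (\<integral>\<^sup>+t. ennreal (v x powr (p - 1)) * indicator {0..<v x} t \<partial>lborel)" for x
    proof -
      have "v x powr p = v x powr (p - 1) * v x"
        using v0[of x] by (cases "v x = 0") (auto simp: powr_diff)
      then show ?thesis using v0[of x]
        by (simp add: nn_integral_cmult ennreal_mult)
    qed
    have slice: "(\<integral>\<^sup>+x. ennreal (v x powr (p - 1)) * indicator {0..<v x} t \<partial>M)
        \<le> ennreal (S powr (1 - 1 / p)) *
            (epowr (emeasure M {x\<in>space M. t < v x}) (1 / p) * indicator {0..} t)" for t :: real
    proof (cases "0 \<le> t")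
      case True
      let ?E = "{x\<in>space M. t < v x}"
      have E: "?E \<in> sets M" by measurable
      have "emeasure M ?E \<le> emeasure M {x\<in>space M. 0 < v x}"
        using True by (intro emeasure_mono) auto
      then obtain \<mu> where \<mu>: "0 \<le> \<mu>" "emeasure M ?E = ennreal \<mu>"
        using supp by (cases "emeasure M ?E") (auto simp: top_unique)
      have eq: "(\<integral>\<^sup>+x. ennreal (v x powr (p - 1)) * indicator {0..<v x} t \<partial>M)
         = (\<integral>\<^sup>+x. ennreal (v x powr (p - 1)) * indicator ?E x \<partial>M)"
        using True by (intro nn_integral_cong) (auto simp: indicator_def)
      show ?thesis
      proof (cases "\<mu> = 0")
        case True
        then have "AE x in M. x \<notin> ?E"
          using \<mu> E by (intro AE_not_in) (simp add: null_sets_def)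
        then have "(\<integral>\<^sup>+x. ennreal (v x powr (p - 1)) * indicator ?E x \<partial>M) = (\<integral>\<^sup>+x. 0 \<partial>M)"
          by (intro nn_integral_cong_AE) (auto elim!: eventually_mono)
        then show ?thesis unfolding eq by simp
      next
        case False
        then show ?thesis
          unfolding eq using Hoelder_on_set[OF _ E v0 p S(2) Spos \<mu>(2)] \<mu> \<open>0 \<le> t\<close>
          by (simp add: epowr_def)
      qed
    qed (auto simp: indicator_def)
    have "ennreal S = (\<integral>\<^sup>+x. \<integral>\<^sup>+t. ennreal (v x powr (p - 1)) * indicator {0..<v x} t \<partial>lborel \<partial>M)"
      unfolding S(2)[symmetric] layer ..
    also have "\<dots> = (\<integral>\<^sup>+t. \<integral>\<^sup>+x. ennreal (v x powr (p - 1)) * indicator {0..<v x} t \<partial>M \<partial>lborel)"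
      by (rule Fubini') (simp add: indicator_def[abs_def] atLeastLessThan_def)
    also have "\<dots> \<le> (\<integral>\<^sup>+t. ennreal (S powr (1 - 1 / p)) *
            (epowr (emeasure M {x\<in>space M. t < v x}) (1 / p) * indicator {0..} t) \<partial>lborel)"
      by (rule nn_integral_mono) (rule slice)
    also have "\<dots> = ennreal (S powr (1 - 1 / p)) * ?J"
      by (rule nn_integral_cmult) measurable
    finally have "ennreal S \<le> ennreal (S powr (1 - 1 / p)) * ?J" .
    moreover have "ennreal S = ennreal (S powr (1 - 1 / p)) * ennreal (S powr (1 / p))"
      using Spos by (simp flip: ennreal_mult powr_add)
    ultimately have "ennreal (S powr (1 / p)) \<le> ?J"
      using Spos by (simp add: ennreal_mult_le_mult_iff)
    then show ?thesis using S by (simp add: epowr_def)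
  qed
qed

text \<open>
  A function whose support has finite measure is the increasing limit of its truncations at
  height \<open>k\<close>. These are bounded, hence have a finite norm, and their level sets are contained in
  those of \<open>v\<close>.
\<close>

lemma (in sigma_finite_measure) Lp_norm_le_level_integral:
  fixes v :: "'a \<Rightarrow> real"
  assumes [measurable]: "v \<in> borel_measurable M"
    and v0: "\<And>x. 0 \<le> v x" and p: "1 < p"
    and supp: "emeasure M {x\<in>space M. 0 < v x} < \<infinity>"
  shows "epowr (\<integral>\<^sup>+x. ennreal (v x powr p) \<partial>M) (1 / p)
           \<le> (\<integral>\<^sup>+t\<in>{0..}. epowr (emeasure M {x\<in>space M. t < v x}) (1 / p) \<partial>lborel)"
    (is "_ \<le> ?J")
proof (cases ?J)
  case (real j)
  define w where "w k x = min (v x) (real k)" for k x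
  have [measurable]: "w k \<in> borel_measurable M" for k unfolding w_def by measurable
  have w0: "0 \<le> w k x" for k x using v0 by (simp add: w_def)
  have bound: "(\<integral>\<^sup>+x. ennreal (w k x powr p) \<partial>M) \<le> ennreal (j powr p)" for k
  proof -
    have wsupp: "emeasure M {x\<in>space M. 0 < w k x} < \<infinity>"
      by (rule le_less_trans[OF emeasure_mono supp]) (auto simp: w_def)
    have "(\<integral>\<^sup>+x. ennreal (w k x powr p) \<partial>M)
        \<le> (\<integral>\<^sup>+x. ennreal (real k powr p) * indicator {x\<in>space M. 0 < w k x} x \<partial>M)"
      using w0 p by (intro nn_integral_mono)
        (auto simp: indicator_def less_le w_def intro!: ennreal_leI powr_mono2)
    also have "\<dots> = ennreal (real k powr p) * emeasure M {x\<in>space M. 0 < w k x}"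
      by (simp add: nn_integral_cmult)
    also have "\<dots> < \<infinity>" using wsupp by (simp add: ennreal_mult_less_top)
    finally have fin: "(\<integral>\<^sup>+x. ennreal (w k x powr p) \<partial>M) < \<infinity>" .
    have "epowr (\<integral>\<^sup>+x. ennreal (w k x powr p) \<partial>M) (1 / p)
        \<le> (\<integral>\<^sup>+t\<in>{0..}. epowr (emeasure M {x\<in>space M. t < w k x}) (1 / p) \<partial>lborel)"
      by (rule Lp_norm_le_level_integral_if_finite[OF _ w0 p wsupp fin]) simp
    also have "\<dots> \<le> ?J"
    proof (rule nn_integral_mono)
      fix t :: real
      have "epowr (emeasure M {x\<in>space M. t < w k x}) (1 / p)
          \<le> epowr (emeasure M {x\<in>space M. t < v x}) (1 / p)" if "0 \<le> t"
      proof (rule epowr_mono)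
        show "emeasure M {x\<in>space M. t < v x} < \<infinity>"
          using that by (intro le_less_trans[OF emeasure_mono supp]) auto
        show "emeasure M {x\<in>space M. t < w k x} \<le> emeasure M {x\<in>space M. t < v x}"
          by (intro emeasure_mono) (auto simp: w_def)
      qed (use p in simp)
      then show "epowr (emeasure M {x\<in>space M. t < w k x}) (1 / p) * indicator {0..} t
          \<le> epowr (emeasure M {x\<in>space M. t < v x}) (1 / p) * indicator {0..} t"
        by (simp add: indicator_def)
    qed
    finally show ?thesis using real p by (simp add: epowr_root_le_iff)
  qed
  have "(\<integral>\<^sup>+x. ennreal (v x powr p) \<partial>M) \<le> (\<integral>\<^sup>+x. (SUP k. ennreal (w k x powr p)) \<partial>M)"
  proof (rule nn_integral_mono)
    fix x
    obtain k :: nat where "v x \<le> real k" using real_arch_simple by blast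
    then have "w k x = v x" by (simp add: w_def)
    then show "ennreal (v x powr p) \<le> (SUP k. ennreal (w k x powr p))"
      by (intro SUP_upper2[of k]) simp_all
  qed
  also have "\<dots> = (SUP k. \<integral>\<^sup>+x. ennreal (w k x powr p) \<partial>M)"
    using p w0 by (intro nn_integral_monotone_convergence_SUP)
      (auto simp: incseq_def le_fun_def w_def intro!: ennreal_leI powr_mono2)
  also have "\<dots> \<le> ennreal (j powr p)"
    by (rule SUP_least) (rule bound)
  finally show ?thesis using real p by (simp add: epowr_root_le_iff)
qed simp

text \<open>
  The zeroth power \<open>epowr _ 0\<close> is \<open>1\<close> on positive values and \<open>0\<close> at \<open>0\<close>, so the right-hand side is
  the length of the set of heights \<open>t \<ge> 0\<close> whose level set is not null. It contains \<open>[0, z]\<close>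
  for every \<open>z\<close> below the essential supremum.
\<close>

lemma (in sigma_finite_measure) esssup_le_level_integral:
  fixes v :: "'a \<Rightarrow> real"
  assumes [measurable]: "v \<in> borel_measurable M"
  shows "esssup M (\<lambda>x. ennreal (v x))
           \<le> (\<integral>\<^sup>+t\<in>{0..}. epowr (emeasure M {x\<in>space M. t < v x}) 0 \<partial>lborel)"
proof (rule dense_le)
  fix z assume z: "z < esssup M (\<lambda>x. ennreal (v x))"
  then obtain c where c: "0 \<le> c" "z = ennreal c" by (cases z) auto
  have pos: "0 < emeasure M {x\<in>space M. z < ennreal (v x)}"
    by (rule esssup_pos_measure[OF _ z]) simp
  have "epowr (emeasure M {x\<in>space M. t < v x}) 0 = 1" if "t \<le> c" for t
  proof (rule epowr_0, rule less_le_trans[OF pos], rule emeasure_mono)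
    show "{x\<in>space M. z < ennreal (v x)} \<subseteq> {x\<in>space M. t < v x}"
      using that c by (auto simp: ennreal_less_iff)
  qed measurable
  then have "(\<integral>\<^sup>+t. indicator {0..c} t \<partial>lborel)
      \<le> (\<integral>\<^sup>+t\<in>{0..}. epowr (emeasure M {x\<in>space M. t < v x}) 0 \<partial>lborel)"
    by (intro nn_integral_mono) (auto simp: indicator_def)
  then show "z \<le> (\<integral>\<^sup>+t\<in>{0..}. epowr (emeasure M {x\<in>space M. t < v x}) 0 \<partial>lborel)"
    using c by simp
qed

lemma (in sigma_finite_measure) Lp_norm_sobolev_exponent_le_level_integral:
  fixes u :: "'a \<Rightarrow> real"
  assumes [measurable]: "u \<in> borel_measurable M" and n: "1 \<le> n"
    and supp: "emeasure M {x\<in>space M. 0 < \<bar>u x\<bar>} < \<infinity>"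
  shows "Lp_norm M (sobolev_exponent n) u
    \<le> (\<integral>\<^sup>+t\<in>{0..}. epowr (emeasure M {x\<in>space M. t < \<bar>u x\<bar>}) ((n - 1) / n) \<partial>lborel)"
proof (cases "n = 1")
  case True
  then show ?thesis
    using esssup_le_level_integral[of "\<lambda>x. \<bar>u x\<bar>"] by (simp add: Lp_norm_def sobolev_exponent_def)
next
  case False
  then have "1 < n / (n - 1)" "1 / (n / (n - 1)) = (n - 1) / n"
    using n by (auto simp: field_simps)
  then show ?thesis
    using Lp_norm_le_level_integral[of "\<lambda>x. \<bar>u x\<bar>" "n / (n - 1)"] supp False
    by (simp add: Lp_norm_def sobolev_exponent_def)
qed

lemma Lp_norm_indicator:
  assumes [measurable]: "A \<in> sets M"
    and A: "0 < emeasure M A" "emeasure M A < \<infinity>" and n: "1 \<le> n"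
  shows "Lp_norm M (sobolev_exponent n) (indicator A) = epowr (emeasure M A) ((n - 1) / n)"
proof (cases "n = 1")
  case True
  have "esssup M (\<lambda>x. ennreal \<bar>indicator A x\<bar>) = 1"
  proof (rule antisym)
    show "esssup M (\<lambda>x. ennreal \<bar>indicator A x\<bar>) \<le> 1"
      by (rule esssup_I) (auto simp: indicator_def)
    show "1 \<le> esssup M (\<lambda>x. ennreal \<bar>indicator A x\<bar>)"
    proof (rule ccontr)
      assume "\<not> ?thesis"
      then have less: "esssup M (\<lambda>x. ennreal \<bar>indicator A x\<bar>) < 1" by simp
      have "AE x in M. x \<notin> A"
        using esssup_AE[of "\<lambda>x. ennreal \<bar>indicator A x\<bar>" M]
        by eventually_elim (use less in \<open>auto simp: indicator_def\<close>)
      then have "emeasure M A = 0"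
        using sets.sets_into_space[OF assms(1)] by (subst (asm) AE_iff_measurable[of A]) auto
      then show False using A by simp
    qed
  qed
  then show ?thesis
    using True A by (simp add: Lp_norm_def sobolev_exponent_def epowr_0)
next
  case False
  have "(\<integral>\<^sup>+x. ennreal (\<bar>indicator A x\<bar> powr (n / (n - 1))) \<partial>M) = (\<integral>\<^sup>+x. indicator A x \<partial>M)"
    by (rule nn_integral_cong) (simp add: indicator_def)
  then show ?thesis
    using False n by (simp add: Lp_norm_def sobolev_exponent_def)
qed

lemma sigma_finite_completion:
  assumes "sigma_finite_measure M"
  shows "sigma_finite_measure (completion M)"
proof -
  interpret sigma_finite_measure M by fact
  obtain A where "countable A" "A \<subseteq> sets M" "\<Union> A = space M" "\<forall>a\<in>A. emeasure M a \<noteq> \<infinity>"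
    using sigma_finite_countable by blast
  then show ?thesis
    by (intro sigma_finite_measure.intro exI[of _ A]) (auto intro: sets_completionI_sets)
qed

section \<open>Reversible random walks and the coarea formula\<close>

locale reversible_random_walk =
  fixes m :: "'a::polish_space \<Rightarrow> 'a measure" and \<nu> :: "'a measure"
  assumes walk: "random_walk m"
    and sigma_finite_\<nu>: "sigma_finite_measure \<nu>"
    and sets_\<nu> [measurable_cong]: "sets \<nu> = sets borel"
    and invariant: "invariant_measure m \<nu>"
    and reversible: "reversible_measure m \<nu>"
begin

lemma prob_space_step: "prob_space (m x)"
  and sets_step [measurable_cong]: "sets (m x) = sets borel"
  using walk by (auto simp: random_walk_def)

lemma space_\<nu> [simp]: "space \<nu> = UNIV"
  using sets_eq_imp_space_eq[OF sets_\<nu>] by simp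

lemma space_step [simp]: "space (m x) = UNIV"
  using sets_eq_imp_space_eq[OF sets_step] by simp

lemma kernel_measurable [measurable]: "m \<in> borel \<rightarrow>\<^sub>M subprob_algebra borel"
  using walk by (intro measurable_subprob_algebra)
    (auto simp: random_walk_def prob_space_imp_subprob_space)

lemma nn_integral_step_measurable:
  assumes "(\<lambda>(x, y). f x y) \<in> borel_measurable (borel \<Otimes>\<^sub>M borel)"
  shows "(\<lambda>x. \<integral>\<^sup>+y. f x y \<partial>m x) \<in> borel_measurable borel"
  by (rule nn_integral_measurable_subprob_algebra2[OF assms kernel_measurable])

text \<open>
  By invariance the average over \<open>x\<close> of the $m_x$-measure of a $\nu$-null Borel set \<open>N\<close> is
  \<open>\<nu> N = 0\<close>.
\<close>

lemma AE_step:
  assumes "AE x in \<nu>. P x"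
  shows "AE x in \<nu>. AE y in m x. P y"
proof -
  obtain N where N: "N \<in> null_sets \<nu>" "{x. \<not> P x} \<subseteq> N"
    using assms unfolding eventually_ae_filter by auto
  then have [measurable]: "N \<in> sets borel" using sets_\<nu> by auto
  have "(\<integral>\<^sup>+x. emeasure (m x) N \<partial>\<nu>) = 0"
    using invariant \<open>N \<in> sets borel\<close> N(1)
    unfolding invariant_measure_def by (metis null_setsD1)
  moreover have "(\<lambda>x. emeasure (m x) N) \<in> borel_measurable \<nu>"
    using walk by (simp add: random_walk_def measurable_cong_sets[OF sets_\<nu> refl])
  ultimately have "AE x in \<nu>. emeasure (m x) N = 0"
    by (simp add: nn_integral_0_iff_AE)
  then show ?thesis
  proof eventually_elim
    case (elim x)
    then have "N \<in> null_sets (m x)" by (simp add: null_sets_def sets_step)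
    then show ?case using N(2) by (intro AE_I') auto
  qed
qed

lemma double_integral_AE_cong:
  assumes "AE x in \<nu>. u x = u' x"
  shows "(\<integral>\<^sup>+x. \<integral>\<^sup>+y. g (u x) (u y) \<partial>m x \<partial>\<nu>) = (\<integral>\<^sup>+x. \<integral>\<^sup>+y. g (u' x) (u' y) \<partial>m x \<partial>\<nu>)"
proof (rule nn_integral_cong_AE)
  show "AE x in \<nu>. (\<integral>\<^sup>+y. g (u x) (u y) \<partial>m x) = (\<integral>\<^sup>+y. g (u' x) (u' y) \<partial>m x)"
    using assms AE_step[OF assms]
  proof eventually_elim
    case (elim x)
    then show ?case
      by (intro nn_integral_cong_AE) (auto elim: eventually_mono)
  qed
qed

lemma TVm_eq: "TVm m \<nu> u = ennreal (1 / 2) * (\<integral>\<^sup>+x. \<integral>\<^sup>+y. ennreal \<bar>u y - u x\<bar> \<partial>m x \<partial>\<nu>)"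
  by (simp add: TVm_def nn_integral_completion)

lemma Pm_eq: "Pm m \<nu> E = (\<integral>\<^sup>+x. \<integral>\<^sup>+y. of_bool (x \<in> E \<and> y \<notin> E) \<partial>m x \<partial>\<nu>)"
proof -
  have "indicator E x * (\<integral>\<^sup>+y. indicator (UNIV - E) y \<partial>m x)
      = (\<integral>\<^sup>+y. of_bool (x \<in> E \<and> y \<notin> E) \<partial>m x)" for x
    by (cases "x \<in> E") (simp_all add: indicator_def[abs_def] of_bool_def)
  then show ?thesis
    by (simp only: Pm_def Lm_def nn_integral_completion)
qed

lemma TVm_AE_cong:
  assumes "AE x in \<nu>. u x = u' x"
  shows "TVm m \<nu> u = TVm m \<nu> u'"
  unfolding TVm_eq using double_integral_AE_cong[OF assms, of "\<lambda>a b. ennreal \<bar>b - a\<bar>"] by simp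

lemma Pm_AE_cong:
  assumes "AE x in \<nu>. x \<in> E \<longleftrightarrow> x \<in> E'"
  shows "Pm m \<nu> E = Pm m \<nu> E'"
  unfolding Pm_eq using assms
  by (intro double_integral_AE_cong[where g = "\<lambda>a b. of_bool (a \<and> \<not> b)"]) simp

text \<open>
  The level \<open>t\<close> lies in the half-open interval from \<open>u y\<close> to \<open>u x\<close> exactly when the step from \<open>x\<close> to
  \<open>y\<close> leaves \<open>{u > t}\<close>; the second equation, for steps that enter it, is reversibility.
\<close>

lemma Pm_level_set:
  fixes u :: "'a \<Rightarrow> real"
  assumes [measurable]: "u \<in> borel_measurable borel"
  shows "Pm m \<nu> {x. t < u x} = (\<integral>\<^sup>+x. \<integral>\<^sup>+y. indicator {u y..<u x} t \<partial>m x \<partial>\<nu>)"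
    and "Pm m \<nu> {x. t < u x} = (\<integral>\<^sup>+x. \<integral>\<^sup>+y. indicator {u x..<u y} t \<partial>m x \<partial>\<nu>)"
proof -
  show 1: "Pm m \<nu> {x. t < u x} = (\<integral>\<^sup>+x. \<integral>\<^sup>+y. indicator {u y..<u x} t \<partial>m x \<partial>\<nu>)"
    unfolding Pm_eq by (intro nn_integral_cong) (auto simp: indicator_def of_bool_def)
  let ?C = "{z :: 'a \<times> 'a. u (snd z) \<le> t \<and> t < u (fst z)}"
  have "{z \<in> space (borel \<Otimes>\<^sub>M borel). u (snd z) \<le> t \<and> t < u (fst z)} \<in> sets (borel \<Otimes>\<^sub>M borel)"
    by measurable
  then have "?C \<in> sets (borel \<Otimes>\<^sub>M borel)" by (simp add: space_pair_measure)
  then have "?C \<in> sets borel" unfolding borel_prod .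
  then have "(\<integral>\<^sup>+x. \<integral>\<^sup>+y. indicator ?C (x, y) \<partial>m x \<partial>\<nu>) = (\<integral>\<^sup>+y. \<integral>\<^sup>+x. indicator ?C (x, y) \<partial>m y \<partial>\<nu>)"
    using reversible by (simp add: reversible_measure_def)
  then show "Pm m \<nu> {x. t < u x} = (\<integral>\<^sup>+x. \<integral>\<^sup>+y. indicator {u x..<u y} t \<partial>m x \<partial>\<nu>)"
    unfolding 1 by (simp add: indicator_def)
qed

text \<open>
  Joint measurability in the starting point and the level, as Tonelli's theorem needs it.
\<close>

lemma nn_integral_step_parameter_measurable:
  fixes f :: "'a \<Rightarrow> 'a \<Rightarrow> real \<Rightarrow> ennreal"
  assumes "(\<lambda>((x, t), y). f x y t) \<in> borel_measurable ((borel \<Otimes>\<^sub>M borel) \<Otimes>\<^sub>M borel)"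
  shows "(\<lambda>(x, t). \<integral>\<^sup>+y. f x y t \<partial>m x) \<in> borel_measurable (borel \<Otimes>\<^sub>M borel)"
proof -
  have "(\<lambda>z. \<integral>\<^sup>+y. f (fst z) y (snd z) \<partial>m (fst z)) \<in> borel_measurable (borel \<Otimes>\<^sub>M borel)"
    by (rule nn_integral_measurable_subprob_algebra2[where N = borel])
      (use assms in \<open>simp_all add: split_beta'\<close>)
  then show ?thesis by (simp add: split_beta')
qed

lemma Pm_level_set_measurable_borel:
  fixes u :: "'a \<Rightarrow> real"
  assumes [measurable]: "u \<in> borel_measurable borel"
  shows "(\<lambda>t. Pm m \<nu> {x. t < u x}) \<in> borel_measurable borel"
proof -
  interpret sigma_finite_measure \<nu> by (rule sigma_finite_\<nu>)
  have [measurable]: "(\<lambda>(x, t). \<integral>\<^sup>+y. indicator {u y..<u x} t \<partial>m x) \<in> borel_measurable (borel \<Otimes>\<^sub>M borel)"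
    by (rule nn_integral_step_parameter_measurable)
      (simp add: indicator_def[abs_def] split_beta')
  show ?thesis unfolding Pm_level_set(1)[OF assms] by measurable
qed

text \<open>
  For fixed \<open>x\<close> and \<open>y\<close> one of the two intervals in \<open>K\<close> is empty and the other has length
  \<open>\<bar>u y - u x\<bar>\<close>. Moving the integral over \<open>t\<close> to the outside leaves, for each level, the flow into
  \<open>{u > t}\<close> plus the flow out of it, and both equal its perimeter.
\<close>

lemma coarea_borel:
  fixes u :: "'a \<Rightarrow> real"
  assumes [measurable]: "u \<in> borel_measurable borel"
  shows "TVm m \<nu> u = (\<integral>\<^sup>+t. Pm m \<nu> {x. t < u x} \<partial>lborel)"
proof -
  define K :: "'a \<Rightarrow> 'a \<Rightarrow> real \<Rightarrow> ennreal"
    where "K x y t = indicator {u x..<u y} t + indicator {u y..<u x} t" for x y t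
  have [measurable]: "(\<lambda>((x, t), y). K x y t) \<in> borel_measurable ((borel \<Otimes>\<^sub>M borel) \<Otimes>\<^sub>M borel)"
    unfolding K_def by (simp add: indicator_def[abs_def] split_beta')
  have "ennreal \<bar>u y - u x\<bar> = (\<integral>\<^sup>+t. K x y t \<partial>lborel)" for x y
    unfolding K_def by (subst nn_integral_add) (auto simp: max_def abs_if)
  then have "(\<integral>\<^sup>+x. \<integral>\<^sup>+y. ennreal \<bar>u y - u x\<bar> \<partial>m x \<partial>\<nu>)
      = (\<integral>\<^sup>+x. \<integral>\<^sup>+y. \<integral>\<^sup>+t. K x y t \<partial>lborel \<partial>m x \<partial>\<nu>)" by simp
  also have "\<dots> = (\<integral>\<^sup>+x. \<integral>\<^sup>+t. \<integral>\<^sup>+y. K x y t \<partial>m x \<partial>lborel \<partial>\<nu>)"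
  proof (rule nn_integral_cong)
    fix x
    interpret prob_space "m x" by (rule prob_space_step)
    interpret pair_sigma_finite lborel "m x" ..
    show "(\<integral>\<^sup>+y. \<integral>\<^sup>+t. K x y t \<partial>lborel \<partial>m x) = (\<integral>\<^sup>+t. \<integral>\<^sup>+y. K x y t \<partial>m x \<partial>lborel)"
      by (rule Fubini') (simp add: K_def indicator_def[abs_def] split_beta')
  qed
  also have "\<dots> = (\<integral>\<^sup>+t. \<integral>\<^sup>+x. \<integral>\<^sup>+y. K x y t \<partial>m x \<partial>\<nu> \<partial>lborel)"
  proof -
    interpret sigma_finite_measure \<nu> by (rule sigma_finite_\<nu>)
    interpret pair_sigma_finite \<nu> lborel ..
    have [measurable]: "(\<lambda>(x, t). \<integral>\<^sup>+y. K x y t \<partial>m x) \<in> borel_measurable (borel \<Otimes>\<^sub>M borel)"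
      by (rule nn_integral_step_parameter_measurable) measurable
    show ?thesis by (rule Fubini'[symmetric]) measurable
  qed
  also have "\<dots> = (\<integral>\<^sup>+t. 2 * Pm m \<nu> {x. t < u x} \<partial>lborel)"
  proof (rule nn_integral_cong)
    fix t
    have "(\<integral>\<^sup>+x. \<integral>\<^sup>+y. K x y t \<partial>m x \<partial>\<nu>)
        = (\<integral>\<^sup>+x. (\<integral>\<^sup>+y. indicator {u x..<u y} t \<partial>m x) + (\<integral>\<^sup>+y. indicator {u y..<u x} t \<partial>m x) \<partial>\<nu>)"
      unfolding K_def by (intro nn_integral_cong nn_integral_add) (simp_all add: indicator_def[abs_def])
    also have "\<dots> = (\<integral>\<^sup>+x. \<integral>\<^sup>+y. indicator {u x..<u y} t \<partial>m x \<partial>\<nu>)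
        + (\<integral>\<^sup>+x. \<integral>\<^sup>+y. indicator {u y..<u x} t \<partial>m x \<partial>\<nu>)"
      by (intro nn_integral_add)
        (simp_all add: measurable_cong_sets[OF sets_\<nu> refl] nn_integral_step_measurable
          indicator_def[abs_def] split_beta')
    also have "\<dots> = Pm m \<nu> {x. t < u x} + Pm m \<nu> {x. t < u x}"
      using Pm_level_set[OF assms, of t] by simp
    finally show "(\<integral>\<^sup>+x. \<integral>\<^sup>+y. K x y t \<partial>m x \<partial>\<nu>) = 2 * Pm m \<nu> {x. t < u x}"
      by (simp add: mult_2)
  qed
  also have "\<dots> = 2 * (\<integral>\<^sup>+t. Pm m \<nu> {x. t < u x} \<partial>lborel)"
    using Pm_level_set_measurable_borel[OF assms] by (intro nn_integral_cmult) simp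
  finally have "TVm m \<nu> u = ennreal (1 / 2) * ennreal 2 * (\<integral>\<^sup>+t. Pm m \<nu> {x. t < u x} \<partial>lborel)"
    unfolding TVm_eq by (simp add: mult.assoc)
  moreover have "ennreal (1 / 2) * ennreal 2 = 1"
    by (subst ennreal_mult[symmetric]) simp_all
  ultimately show ?thesis by simp
qed

lemma
  fixes u :: "'a \<Rightarrow> real"
  assumes "u \<in> borel_measurable (completion \<nu>)"
  shows coarea: "TVm m \<nu> u = (\<integral>\<^sup>+t. Pm m \<nu> {x. t < u x} \<partial>lborel)"
    and Pm_level_set_measurable: "(\<lambda>t. Pm m \<nu> {x. t < u x}) \<in> borel_measurable borel"
proof -
  obtain u' where u': "u' \<in> borel_measurable \<nu>" "AE x in \<nu>. u x = u' x"
    using completion_ex_borel_measurable_real[OF assms] by blast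
  then have u'_borel: "u' \<in> borel_measurable borel"
    by (simp add: measurable_cong_sets[OF sets_\<nu> refl])
  have Pm: "Pm m \<nu> {x. t < u x} = Pm m \<nu> {x. t < u' x}" for t
    using u'(2) by (intro Pm_AE_cong) (auto elim: eventually_mono)
  show "TVm m \<nu> u = (\<integral>\<^sup>+t. Pm m \<nu> {x. t < u x} \<partial>lborel)"
    unfolding Pm TVm_AE_cong[OF u'(2)] by (rule coarea_borel[OF u'_borel])
  show "(\<lambda>t. Pm m \<nu> {x. t < u x}) \<in> borel_measurable borel"
    unfolding Pm by (rule Pm_level_set_measurable_borel[OF u'_borel])
qed

lemma TVm_indicator:
  assumes "A \<in> sets (completion \<nu>)"
  shows "TVm m \<nu> (indicator A) = Pm m \<nu> A"
proof -
  have "Pm m \<nu> {x. t < indicator A x} = Pm m \<nu> A * indicator {0..<1} t" for t :: real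
  proof -
    \<comment> \<open>The level sets are the whole space for \<open>t < 0\<close> and empty for \<open>t \<ge> 1\<close>; both have perimeter \<open>0\<close>.\<close>
    consider "t < 0" | "0 \<le> t" "t < 1" | "1 \<le> t" by linarith
    then show ?thesis
    proof cases
      case 1
      then have "{x. t < indicator A x} = UNIV" by (auto simp: indicator_def)
      then show ?thesis using 1 by (simp add: Pm_eq)
    next
      case 2
      then have "{x. t < indicator A x} = A" by (auto simp: indicator_def)
      then show ?thesis using 2 by simp
    next
      case 3
      then have "{x. t < indicator A x} = {}" by (auto simp: indicator_def)
      then show ?thesis using 3 by (simp add: Pm_eq)
    qed
  qed
  then show ?thesis
    using assms by (subst coarea) (simp_all add: nn_integral_cmult)
qed

lemma TVm_abs_le: "TVm m \<nu> (\<lambda>x. \<bar>u x\<bar>) \<le> TVm m \<nu> u"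
  unfolding TVm_eq by (intro mult_left_mono nn_integral_mono ennreal_leI) auto

section \<open>The isoperimetric and Sobolev inequalities\<close>

lemma sobolev_imp_isoperimetric:
  assumes n: "1 \<le> n" and I: "0 < I"
    and sobolev: "\<And>u. u \<in> BVm0 m \<nu> \<Longrightarrow>
      Lp_norm (completion \<nu>) (sobolev_exponent n) u \<le> ennreal I * TVm m \<nu> u"
  shows "isoperimetric_inequality m \<nu> n I"
  unfolding isoperimetric_inequality_def
proof (intro ballI impI)
  fix A assume A: "A \<in> sets (completion \<nu>)" "0 < emeasure (completion \<nu>) A"
    "emeasure (completion \<nu>) A < emeasure (completion \<nu>) UNIV"
  show "epowr (emeasure (completion \<nu>) A) ((n - 1) / n) \<le> ennreal I * Pm m \<nu> A"
  proof (cases "Pm m \<nu> A = \<infinity>")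
    case True
    \<comment> \<open>The indicator of \<open>A\<close> is not in \<^const>\<open>BVm\<close> here, and the claim holds because \<open>I > 0\<close>.\<close>
    then show ?thesis using I by (simp add: ennreal_mult_top)
  next
    case False
    then have "indicator A \<in> BVm m \<nu>"
      using A by (simp add: BVm_def TVm_indicator less_top)
    then have "indicator A \<in> BVm0 m \<nu>"
      using A unfolding BVm0_def by (auto intro!: bexI[of _ A])
    from sobolev[OF this]
    have "Lp_norm (completion \<nu>) (sobolev_exponent n) (indicator A) \<le> ennreal I * Pm m \<nu> A"
      by (simp only: TVm_indicator[OF A(1)])
    moreover have "emeasure (completion \<nu>) A < \<infinity>"
      using less_le_trans[OF A(3) top_greatest] by (simp only: infinity_ennreal_def)
    ultimately show ?thesis
      by (simp only: Lp_norm_indicator[OF A(1,2) _ n])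
  qed
qed

lemma isoperimetric_imp_sobolev:
  assumes n: "1 \<le> n" and iso: "isoperimetric_inequality m \<nu> n I"
    and u: "u \<in> BVm0 m \<nu>"
  shows "Lp_norm (completion \<nu>) (sobolev_exponent n) u \<le> ennreal I * TVm m \<nu> u"
proof -
  let ?\<nu> = "completion \<nu>" and ?E = "\<lambda>t. {x. t < \<bar>u x\<bar>}"
  interpret sigma_finite_measure ?\<nu>
    by (rule sigma_finite_completion) (rule sigma_finite_\<nu>)
  have [measurable]: "u \<in> borel_measurable ?\<nu>"
    using u by (simp add: BVm0_def BVm_def)
  obtain A where A: "A \<in> sets ?\<nu>" "emeasure ?\<nu> A < emeasure ?\<nu> UNIV" "\<And>x. x \<notin> A \<Longrightarrow> u x = 0"
    using u by (auto simp: BVm0_def)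
  have E_sets: "?E t \<in> sets ?\<nu>" for t
  proof -
    have "{x\<in>space ?\<nu>. t < \<bar>u x\<bar>} \<in> sets ?\<nu>" by measurable
    then show ?thesis by simp
  qed
  have E_small: "emeasure ?\<nu> (?E t) < emeasure ?\<nu> UNIV" if "0 \<le> t" for t
  proof -
    have "?E t \<subseteq> A" using A(3) that by fastforce
    then show ?thesis using A(1,2) by (meson emeasure_mono le_less_trans)
  qed
  have level: "epowr (emeasure ?\<nu> (?E t)) ((n - 1) / n) \<le> ennreal I * Pm m \<nu> (?E t)"
    if "0 \<le> t" for t
  proof (cases "emeasure ?\<nu> (?E t) = 0")
    case True
    \<comment> \<open>A null level set has \<open>epowr 0 _ = 0\<close>, also for the exponent \<open>0\<close> of the case \<open>n = 1\<close>.\<close>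
    then show ?thesis by (simp add: epowr_def)
  next
    case False
    then show ?thesis
      using iso E_sets E_small[OF that] unfolding isoperimetric_inequality_def
      by (simp add: zero_less_iff_neq_zero)
  qed
  have supp: "emeasure ?\<nu> (?E 0) < \<infinity>"
    using less_le_trans[OF E_small[of 0] top_greatest] by (simp only: infinity_ennreal_def order_refl)
  have "Lp_norm ?\<nu> (sobolev_exponent n) u
      \<le> (\<integral>\<^sup>+t\<in>{0..}. epowr (emeasure ?\<nu> (?E t)) ((n - 1) / n) \<partial>lborel)"
    using Lp_norm_sobolev_exponent_le_level_integral[of u n] n supp by simp
  also have "\<dots> \<le> (\<integral>\<^sup>+t. ennreal I * Pm m \<nu> (?E t) \<partial>lborel)"
    using level by (intro nn_integral_mono) (auto simp: indicator_def)
  also have "\<dots> = ennreal I * TVm m \<nu> (\<lambda>x. \<bar>u x\<bar>)"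
    using Pm_level_set_measurable[of "\<lambda>x. \<bar>u x\<bar>"]
    by (subst coarea) (auto intro!: nn_integral_cmult)
  also have "\<dots> \<le> ennreal I * TVm m \<nu> u"
    by (intro mult_left_mono TVm_abs_le) simp
  finally show ?thesis .
qed

lemma isoperimetric_iff_sobolev:
  assumes "1 \<le> n" and "0 < I"
  shows "isoperimetric_inequality m \<nu> n I \<longleftrightarrow>
    (\<forall>u\<in>BVm0 m \<nu>. Lp_norm (completion \<nu>) (sobolev_exponent n) u \<le> ennreal I * TVm m \<nu> u)"
  using sobolev_imp_isoperimetric[OF assms] isoperimetric_imp_sobolev[OF assms(1)] by blast

end

theorem theorem2p11:
  fixes m :: "'a::polish_space \<Rightarrow> 'a measure" and \<nu> :: "'a measure" and n I :: real
  assumes "random_walk m"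
    and "sigma_finite_measure \<nu>" and "radon_measure \<nu>"
    and "invariant_measure m \<nu>" and "reversible_measure m \<nu>"
    and "m_connected m \<nu>"
    and "n \<ge> 1" and "I > 0"
  shows "(isoperimetric_inequality m \<nu> n I \<longleftrightarrow>
            (\<forall>u\<in>BVm0 m \<nu>. Lp_norm (completion \<nu>) (sobolev_exponent n) u \<le> ennreal I * TVm m \<nu> u)) \<and>
         (has_isoperimetric_dimension m \<nu> n \<longleftrightarrow>
            (\<exists>J>0. \<forall>u\<in>BVm0 m \<nu>.
               Lp_norm (completion \<nu>) (sobolev_exponent n) u \<le> ennreal J * TVm m \<nu> u))"
proof -
  have "sets \<nu> = sets borel"
    using \<open>radon_measure \<nu>\<close> unfolding radon_measure_def by (rule conjunct1)
  then interpret reversible_random_walk m \<nu>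
    by (intro reversible_random_walk.intro assms)
  note iff = isoperimetric_iff_sobolev[OF \<open>n \<ge> 1\<close>]
  have "has_isoperimetric_dimension m \<nu> n \<longleftrightarrow>
      (\<exists>J>0. \<forall>u\<in>BVm0 m \<nu>.
         Lp_norm (completion \<nu>) (sobolev_exponent n) u \<le> ennreal J * TVm m \<nu> u)"
    unfolding has_isoperimetric_dimension_def
    by (intro ex_cong1 conj_cong refl iff)
  with iff[OF \<open>I > 0\<close>] show ?thesis by (rule conjI)
qed

end
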